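(* Let $U_2=S^6\setminus\{i\}$ and let $\tilde Q\colon U_2\to G_2$, $\xi\mapsto\tilde Q_\xi$, be a smooth map with $\tilde Q_\xi(-i)=\xi$ for all $\xi\in U_2$. For $\xi\in U_2$ put $\tilde a=\tilde Q_\xi(j)$, $\tilde b=\tilde Q_\xi(e)$, $\tilde c=\tilde Q_\xi(g)$, and for $\varphi\in p^{-1}(\xi)$ put $\eta=\varphi(j)$, $\zeta=\varphi(e)$ and $$\tilde\theta_\xi(\varphi)=\begin{pmatrix}\langle\eta,\tilde a\rangle+I\langle\eta,J_\xi(\tilde a)\rangle & \langle\zeta,\tilde a\rangle+I\langle\zeta,J_\xi(\tilde a)\rangle & \langle\eta\zeta,\tilde a\rangle+I\langle\eta\zeta,J_\xi(\tilde a)\rangle\\ \langle\eta,\tilde b\rangle+I\langle\eta,J_\xi(\tilde b)\rangle & \langle\zeta,\tilde b\rangle+I\langle\zeta,J_\xi(\tilde b)\rangle & \langle\eta\zeta,\tilde b\rangle+I\langle\eta\zeta,J_\xi(\tilde b)\rangle\\ \langle\eta,\tilde c\rangle+I\langle\eta,J_\xi(\tilde c)\rangle & \langle\zeta,\tilde c\rangle+I\langle\zeta,J_\xi(\tilde c)\rangle & \langle\eta\zeta,\tilde c\rangle+I\langle\eta\zeta,J_\xi(\tilde c)\rangle\end{pmatrix}.$$ Then $\tilde\theta_\xi(\varphi)\in\mathrm{SU}(3)$, and $$\psi_2\colon p^{-1}(U_2)\to U_2\times\mathrm{SU}(3),\qquad \varphi\mapsto(\varphi(i),\tilde\theta_{\varphi(i)}(\varphi))$$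 is a local trivialization over $U_2$ of the principal $\mathrm{SU}(3)$-bundle $p\colon G_2\to S^6$.
   Context: Octonions: $\mathbb{O}=\mathbb{H}\oplus\mathbb{H}$ with multiplication $(a,b)(u,v)=(au-\bar v b,\ b\bar u+va)$ and conjugation $\overline{(a,b)}=(\bar a,-b)$. A quaternion $a$ is identified with $(a,0)$, and $e=(0,1)$. The real basis $1,i,j,k,e,f=ie,g=je,h=ke$ is orthonormal for the Euclidean inner product $\langle\cdot,\cdot\rangle$ with $|x|^2=x\bar x$. $G_2=\operatorname{Aut}\mathbb{O}$ is the group of real algebra automorphisms of $\mathbb{O}$. $S^6$ is the unit sphere in the space of purely imaginary octonions, and $p\colon G_2\to S^6$, $\varphi\mapsto\varphi(i)$. For $\xi\in S^6$, $V_\xi=T_\xi S^6$ is the space of purely imaginary octonions orthogonal to $\xi$, with complex structure $J_\xi(x)=\xi x$. $I$ denotes the imaginary unit of $\mathbb{C}$, to distinguish it from the octonion $i$. The stabilizer $K=p^{-1}(i)$ acts on $G_2$ on the right by composition, and it is identified with $\mathrm{SU}(3)$ by sending $\Phi\in K$ to the matrix of the complex linear map $\Phi|_{V_i}$ in the complex basis $j,e,g$ of $(V_i,J_i)$; this makes $p$ a principal $\mathrm{SU}(3)$-bundle. A local trivialization over $U_2$ is a diffeomorphism $p^{-1}(U_2)\to U_2\times\mathrm{SU}(3)$ over $U_2$ that is equivariant for the right $\mathrm{SU}(3)$-actions. *)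

theory Defs
  imports "HOL-Analysis.Analysis"
begin

subsection \<open>Quaternions and octonions\<close>

text \<open>
  A quaternion \<open>(a, b, c, d)\<close> stands for \<open>a + b i + c j + d k\<close>, and an octonion is a pair of
  quaternions. The inner product, norm and topology are those of the product type, for which
  \<open>1, i, j, k, e, f, g, h\<close> is orthonormal (lemmas \<open>octonion_basis_orthonormal\<close> and
  \<open>omult_oconj\<close> below). Only the multiplication has to be introduced.
\<close>

type_synonym quaternion = "real \<times> real \<times> real \<times> real"
type_synonym octonion = "quaternion \<times> quaternion"

fun qmult :: "quaternion \<Rightarrow> quaternion \<Rightarrow> quaternion" (infixl "*\<^sub>H" 70) where
  "(a1, b1, c1, d1) *\<^sub>H (a2, b2, c2, d2) =
     (a1 * a2 - b1 * b2 - c1 * c2 - d1 * d2,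
      a1 * b2 + b1 * a2 + c1 * d2 - d1 * c2,
      a1 * c2 - b1 * d2 + c1 * a2 + d1 * b2,
      a1 * d2 + b1 * c2 - c1 * b2 + d1 * a2)"

fun qconj :: "quaternion \<Rightarrow> quaternion" where
  "qconj (a, b, c, d) = (a, - b, - c, - d)"

fun omult :: "octonion \<Rightarrow> octonion \<Rightarrow> octonion" (infixl "*\<^sub>O" 70) where
  "(a, b) *\<^sub>O (u, v) = (a *\<^sub>H u - qconj v *\<^sub>H b, b *\<^sub>H qconj u + v *\<^sub>H a)"

fun oconj :: "octonion \<Rightarrow> octonion" where
  "oconj (a, b) = (qconj a, - b)"

definition oct_1 :: octonion where "oct_1 = ((1, 0, 0, 0), 0)"
definition oct_i :: octonion where "oct_i = ((0, 1, 0, 0), 0)"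
definition oct_j :: octonion where "oct_j = ((0, 0, 1, 0), 0)"
definition oct_k :: octonion where "oct_k = ((0, 0, 0, 1), 0)"
definition oct_e :: octonion where "oct_e = (0, (1, 0, 0, 0))"
definition oct_f :: octonion where "oct_f = oct_i *\<^sub>O oct_e"
definition oct_g :: octonion where "oct_g = oct_j *\<^sub>O oct_e"
definition oct_h :: octonion where "oct_h = oct_k *\<^sub>O oct_e"

lemmas oct_basis_defs =
  oct_1_def oct_i_def oct_j_def oct_k_def oct_e_def oct_f_def oct_g_def oct_h_def

definition oct_imaginary :: "octonion set" where
  "oct_imaginary = {x. oconj x = - x}"

lemma omult_oconj: "x *\<^sub>O oconj x = ((norm x)\<^sup>2) *\<^sub>R oct_1"
proof -
  obtain a b c d a' b' c' d' where x: "x = ((a, b, c, d), (a', b', c', d'))"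
    by (metis surj_pair)
  show ?thesis
    unfolding x dot_square_norm[symmetric]
    by (simp add: oct_1_def zero_prod_def algebra_simps power2_eq_square)
qed

lemma octonion_basis_orthonormal:
  "\<forall>m < 8. \<forall>n < 8.
     [oct_1, oct_i, oct_j, oct_k, oct_e, oct_f, oct_g, oct_h] ! m \<bullet>
     [oct_1, oct_i, oct_j, oct_k, oct_e, oct_f, oct_g, oct_h] ! n = (if m = n then 1 else 0)"
  by (simp add: oct_basis_defs zero_prod_def less_Suc_eq numeral_eq_Suc all_conj_distrib)


subsection \<open>Smooth maps between subsets of Euclidean spaces\<close>

text \<open>
  \<open>Ck_on n W f\<close> is meant for open \<open>W\<close> in a finite-dimensional space. There all directional
  derivatives being of class \<open>C^n\<close> is the same as the total derivative being so.
\<close>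

fun Ck_on :: "nat \<Rightarrow> 'a::real_normed_vector set \<Rightarrow> ('a \<Rightarrow> 'b::real_normed_vector) \<Rightarrow> bool" where
  "Ck_on 0 W f \<longleftrightarrow> continuous_on W f"
| "Ck_on (Suc n) W f \<longleftrightarrow>
     (\<forall>x\<in>W. f differentiable (at x)) \<and> (\<forall>v. Ck_on n W (\<lambda>x. frechet_derivative f (at x) v))"

text \<open>
  \<open>S^6\<close>, \<open>G_2\<close> and \<open>SU(3)\<close> are embedded submanifolds of the spaces of octonions, of real
  endomorphisms of the octonions, and of complex 3x3 matrices. A map between (open subsets of)
  embedded submanifolds is smooth iff it extends, near each point, to a smooth map of the
  ambient spaces.
\<close>

definition smooth_map_on :: "'a::real_normed_vector set \<Rightarrow> ('a \<Rightarrow> 'b::real_normed_vector) \<Rightarrow> bool" where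
  "smooth_map_on S f \<longleftrightarrow>
     (\<forall>x\<in>S. \<exists>W F. open W \<and> x \<in> W \<and> (\<forall>n. Ck_on n W F) \<and> (\<forall>y\<in>S \<inter> W. F y = f y))"

definition diffeomorphism_onto ::
  "'a::real_normed_vector set \<Rightarrow> 'b::real_normed_vector set \<Rightarrow> ('a \<Rightarrow> 'b) \<Rightarrow> bool" where
  "diffeomorphism_onto S T f \<longleftrightarrow>
     bij_betw f S T \<and> smooth_map_on S f \<and> smooth_map_on T (inv_into S f)"


subsection \<open>The projection from \<open>G_2\<close> to \<open>S^6\<close>\<close>

definition G2 :: "(octonion \<Rightarrow>\<^sub>L octonion) set" where
  "G2 = {\<phi>. bij (blinfun_apply \<phi>) \<and> (\<forall>x y. \<phi> (x *\<^sub>O y) = \<phi> x *\<^sub>O \<phi> y)}"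

definition S6 :: "octonion set" where
  "S6 = {x \<in> oct_imaginary. norm x = 1}"

definition p_G2 :: "(octonion \<Rightarrow>\<^sub>L octonion) \<Rightarrow> octonion" where
  "p_G2 \<phi> = \<phi> oct_i"

definition preim_p :: "octonion set \<Rightarrow> (octonion \<Rightarrow>\<^sub>L octonion) set" where
  "preim_p U = {\<phi> \<in> G2. p_G2 \<phi> \<in> U}"

definition J_cx :: "octonion \<Rightarrow> octonion \<Rightarrow> octonion" where
  "J_cx \<xi> x = \<xi> *\<^sub>O x"


subsection \<open>The right action of \<open>SU(3)\<close> on \<open>G_2\<close>\<close>

definition cadjoint :: "complex^'n^'m \<Rightarrow> complex^'m^'n" where
  "cadjoint A = (\<chi> r s. cnj (A $ s $ r))"

definition SU3 :: "(complex^3^3) set" where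
  "SU3 = {A. A ** cadjoint A = mat 1 \<and> cadjoint A ** A = mat 1 \<and> det A = 1}"

definition stab_K :: "(octonion \<Rightarrow>\<^sub>L octonion) set" where
  "stab_K = preim_p {oct_i}"

text \<open>Scalar multiplication by a complex number for the complex structure \<open>J_cx \<xi>\<close>.\<close>

definition cscale :: "octonion \<Rightarrow> complex \<Rightarrow> octonion \<Rightarrow> octonion" where
  "cscale \<xi> z x = Re z *\<^sub>R x + Im z *\<^sub>R J_cx \<xi> x"

definition basis_Vi :: "octonion^3" where
  "basis_Vi = vector [oct_j, oct_e, oct_g]"

text \<open>
  The matrix of the restriction of \<open>\<Phi> \<in> stab_K\<close> to the imaginary octonions orthogonal to \<open>i\<close>, in
  the complex basis \<open>j, e, g\<close>; its columns are the coordinates of the images of the basis.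
\<close>

definition mat_K :: "(octonion \<Rightarrow>\<^sub>L octonion) \<Rightarrow> complex^3^3" where
  "mat_K \<Phi> = (THE M. \<forall>s. \<Phi> (basis_Vi $ s) = (\<Sum>r\<in>UNIV. cscale oct_i (M $ r $ s) (basis_Vi $ r)))"

text \<open>\<open>mat_K\<close> is a bijection from \<open>stab_K\<close> to \<open>SU3\<close>; its inverse turns composition into an action.\<close>

definition act_SU3 :: "(octonion \<Rightarrow>\<^sub>L octonion) \<Rightarrow> complex^3^3 \<Rightarrow> (octonion \<Rightarrow>\<^sub>L octonion)" where
  "act_SU3 \<phi> A = \<phi> o\<^sub>L inv_into stab_K mat_K A"

definition local_trivialization ::
  "octonion set \<Rightarrow> ((octonion \<Rightarrow>\<^sub>L octonion) \<Rightarrow> octonion \<times> (complex^3^3)) \<Rightarrow> bool" where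
  "local_trivialization U \<psi> \<longleftrightarrow>
     diffeomorphism_onto (preim_p U) (U \<times> SU3) \<psi> \<and>
     (\<forall>\<phi>\<in>preim_p U. fst (\<psi> \<phi>) = p_G2 \<phi>) \<and>
     (\<forall>\<phi>\<in>preim_p U. \<forall>A\<in>SU3. \<psi> (act_SU3 \<phi> A) = (fst (\<psi> \<phi>), snd (\<psi> \<phi>) ** A))"


subsection \<open>The map over \<open>U_2\<close>\<close>

definition U2 :: "octonion set" where
  "U2 = S6 - {oct_i}"

definition coord :: "octonion \<Rightarrow> octonion \<Rightarrow> octonion \<Rightarrow> complex" where
  "coord \<xi> x a = complex_of_real (x \<bullet> a) + \<i> * complex_of_real (x \<bullet> J_cx \<xi> a)"

definition theta ::
  "(octonion \<Rightarrow> octonion \<Rightarrow>\<^sub>L octonion) \<Rightarrow> octonion \<Rightarrow> (octonion \<Rightarrow>\<^sub>L octonion) \<Rightarrow> complex^3^3" where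
  "theta Q \<xi> \<phi> =
     (let a = Q \<xi> oct_j; b = Q \<xi> oct_e; c = Q \<xi> oct_g; \<eta> = \<phi> oct_j; \<zeta> = \<phi> oct_e
      in vector [vector [coord \<xi> \<eta> a, coord \<xi> \<zeta> a, coord \<xi> (\<eta> *\<^sub>O \<zeta>) a],
                 vector [coord \<xi> \<eta> b, coord \<xi> \<zeta> b, coord \<xi> (\<eta> *\<^sub>O \<zeta>) b],
                 vector [coord \<xi> \<eta> c, coord \<xi> \<zeta> c, coord \<xi> (\<eta> *\<^sub>O \<zeta>) c]])"

definition psi2 ::
  "(octonion \<Rightarrow> octonion \<Rightarrow>\<^sub>L octonion) \<Rightarrow> (octonion \<Rightarrow>\<^sub>L octonion) \<Rightarrow> octonion \<times> (complex^3^3)" where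
  "psi2 Q \<phi> = (p_G2 \<phi>, theta Q (p_G2 \<phi>) \<phi>)"

end

theory Submission
  imports Defs
begin

text \<open>
  Let \<open>\<tau>\<close> be the automorphism of the octonions with \<open>i \<mapsto> -i\<close>, \<open>j \<mapsto> j\<close>, \<open>e \<mapsto> e\<close>. It also fixes \<open>g\<close>, so
  \<open>P \<xi> = Q \<xi> \<circ> \<tau>\<close> is a smooth section of \<open>p\<close> over \<open>U2\<close> with the same values on \<open>j, e, g\<close> as \<open>Q \<xi>\<close>.
  Since automorphisms are isometries, \<open>theta Q \<xi> \<phi>\<close> is the matrix of \<open>(P \<xi>)\<^sup>-\<^sup>1 \<circ> \<phi>\<close> in the stabilizer of
  \<open>i\<close>, and the inverse of the trivialization is \<open>(\<xi>, A) \<mapsto> P \<xi> \<circ> A\<close>. The identification of the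
  stabilizer with \<open>SU(3)\<close> is read off from the product of \<open>\<complex> \<oplus> \<complex>\<^sup>3\<close>,
  \<open>(\<alpha>, z) (\<beta>, w) = (\<alpha> \<beta> - \<langle>z, w\<rangle>, \<alpha> w + cnj \<beta> z + cnj (z \<times> w))\<close>.
\<close>

section \<open>Calculus of \<open>Ck_on\<close>\<close>

text \<open>On an open set the derivative at a point depends on nearby values only, so maps that
  agree on \<open>W\<close> have the same directional derivatives there, and the induction passes on
  to these.\<close>

lemma Ck_on_cong:
  assumes "open W" "\<And>x. x \<in> W \<Longrightarrow> f x = g x" "Ck_on n W f"
  shows "Ck_on n W g"
  using assms(2,3)
proof (induction n arbitrary: f g)
  case 0
  then show ?case using continuous_on_cong[of W W f g] by simp
next
  case (Suc n)
  have D: "(g has_derivative frechet_derivative f (at x)) (at x)" if "x \<in> W" for x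
  proof (rule has_derivative_transform_within_open[OF _ \<open>open W\<close> that])
    show "(f has_derivative frechet_derivative f (at x)) (at x)"
      using Suc.prems(2) that by (simp add: frechet_derivative_works)
  qed (simp add: Suc.prems(1))
  have "Ck_on n W (\<lambda>x. frechet_derivative g (at x) v)" for v
  proof (rule Suc.IH)
    show "Ck_on n W (\<lambda>x. frechet_derivative f (at x) v)" using Suc.prems(2) by simp
    show "frechet_derivative f (at x) v = frechet_derivative g (at x) v" if "x \<in> W" for x
      using frechet_derivative_at[OF D[OF that]] by simp
  qed
  then show ?case using D by (auto simp: differentiable_def)
qed

lemma Ck_on_subset: "Ck_on n W f \<Longrightarrow> V \<subseteq> W \<Longrightarrow> Ck_on n V f"
proof (induction n arbitrary: f)
  case 0
  then show ?case by (simp add: continuous_on_subset)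
next
  case (Suc n)
  then show ?case by (simp add: subset_iff)
qed

text \<open>Derivatives are unique, so any explicit derivative may stand in for
  \<open>frechet_derivative\<close>.\<close>

lemma Ck_on_SucI:
  assumes "open W" "\<And>x. x \<in> W \<Longrightarrow> (f has_derivative f' x) (at x)"
    and "\<And>v. Ck_on n W (\<lambda>x. f' x v)"
  shows "Ck_on (Suc n) W f"
proof -
  have "Ck_on n W (\<lambda>x. frechet_derivative f (at x) v)" for v
    by (rule Ck_on_cong[OF assms(1) _ assms(3)[of v]])
      (simp add: frechet_derivative_at[OF assms(2), symmetric])
  then show ?thesis using assms(2) by (auto simp: differentiable_def)
qed

lemma Ck_on_SucD:
  assumes "Ck_on (Suc n) W f" "x \<in> W"
  shows "(f has_derivative frechet_derivative f (at x)) (at x)"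
  using assms by (simp add: frechet_derivative_works)

lemma Ck_on_Suc_imp: "Ck_on (Suc n) W f \<Longrightarrow> Ck_on n W f"
proof (induction n arbitrary: f)
  case 0
  then show ?case
    by (simp add: differentiable_imp_continuous_on differentiable_at_imp_differentiable_on)
next
  case (Suc n)
  have "Ck_on (Suc n) W (\<lambda>x. frechet_derivative f (at x) v)" for v
    using Suc.prems by (subst (asm) Ck_on.simps(2)) blast
  then have "Ck_on n W (\<lambda>x. frechet_derivative f (at x) v)" for v
    by (rule Suc.IH)
  moreover have "\<forall>x\<in>W. f differentiable (at x)" using Suc.prems by simp
  ultimately show ?case by simp
qed

lemma Ck_on_const: "open W \<Longrightarrow> Ck_on n W (\<lambda>x. c)"
proof (induction n arbitrary: c)
  case (Suc n)
  then show ?case by (intro Ck_on_SucI[where f' = "\<lambda>x v. 0"]) auto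
qed auto

lemma Ck_on_add:
  assumes "open W"
  shows "Ck_on n W f \<Longrightarrow> Ck_on n W g \<Longrightarrow> Ck_on n W (\<lambda>x. f x + g x)"
proof (induction n arbitrary: f g)
  case 0
  then show ?case by (auto intro: continuous_intros)
next
  case (Suc n)
  show ?case
  proof (rule Ck_on_SucI[OF assms])
    show "((\<lambda>x. f x + g x) has_derivative
        (\<lambda>v. frechet_derivative f (at x) v + frechet_derivative g (at x) v)) (at x)"
      if "x \<in> W" for x
      by (intro has_derivative_add Ck_on_SucD[OF Suc.prems(1) that] Ck_on_SucD[OF Suc.prems(2) that])
  qed (use Suc in auto)
qed

lemma Ck_on_sum:
  assumes "open W" "\<And>i. i \<in> I \<Longrightarrow> Ck_on n W (f i)"
  shows "Ck_on n W (\<lambda>x. \<Sum>i\<in>I. f i x)"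
  using assms(2)
  by (induction I rule: infinite_finite_induct) (auto simp: Ck_on_const Ck_on_add assms(1))

lemma Ck_on_bounded_linear:
  assumes "open W" "bounded_linear h"
  shows "Ck_on n W f \<Longrightarrow> Ck_on n W (\<lambda>x. h (f x))"
proof (induction n arbitrary: f)
  case 0
  then show ?case using bounded_linear.continuous_on[OF assms(2)] by simp
next
  case (Suc n)
  show ?case
  proof (rule Ck_on_SucI[OF assms(1)])
    show "((\<lambda>x. h (f x)) has_derivative (\<lambda>v. h (frechet_derivative f (at x) v))) (at x)"
      if "x \<in> W" for x
      by (rule bounded_linear.has_derivative[OF assms(2) Ck_on_SucD[OF Suc.prems that]])
  qed (use Suc in auto)
qed

lemma Ck_on_linear:
  assumes "open W" "bounded_linear h"
  shows "Ck_on n W h"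
proof (cases n)
  case 0
  then show ?thesis by (simp add: linear_continuous_on assms(2))
next
  case (Suc m)
  show ?thesis
    unfolding Suc
    by (rule Ck_on_SucI[OF assms(1)])
      (auto intro: bounded_linear_imp_has_derivative assms Ck_on_const)
qed

text \<open>The derivative of the composite along \<open>v\<close> is that of \<open>f\<close> along
  \<open>l v\<close>, again composed with \<open>l\<close>. The induction therefore stays within
  composites with the same linear map.\<close>

lemma Ck_on_compose_bounded_linear:
  assumes "open W" "bounded_linear l"
  shows "Ck_on n W f \<Longrightarrow> Ck_on n (l -` W) (\<lambda>x. f (l x))"
proof (induction n arbitrary: f)
  case 0
  then show ?case
    using continuous_on_compose2[OF _ linear_continuous_on[OF assms(2)]] by fastforce
next
  case (Suc n)
  have "open (l -` W)"
    using assms by (simp add: continuous_open_vimage linear_continuous_at)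
  then show ?case
  proof (rule Ck_on_SucI)
    show "((\<lambda>x. f (l x)) has_derivative (\<lambda>v. frechet_derivative f (at (l x)) (l v))) (at x)"
      if "x \<in> l -` W" for x
      using has_derivative_compose[OF bounded_linear_imp_has_derivative[OF assms(2)]
          Ck_on_SucD[OF Suc.prems]] that by auto
  qed (use Suc in auto)
qed

text \<open>The Leibniz rule yields two products of the same kind; the undifferentiated factor is
  weakened by one order before the induction hypothesis applies.\<close>

lemma (in bounded_bilinear) Ck_on:
  assumes "open W"
  shows "Ck_on n W f \<Longrightarrow> Ck_on n W g \<Longrightarrow> Ck_on n W (\<lambda>x. prod (f x) (g x))"
proof (induction n arbitrary: f g)
  case 0
  then show ?case by (auto intro: continuous_on)
next
  case (Suc n)
  show ?case
  proof (rule Ck_on_SucI[OF assms])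
    show "((\<lambda>x. prod (f x) (g x)) has_derivative
        (\<lambda>v. prod (f x) (frechet_derivative g (at x) v) + prod (frechet_derivative f (at x) v) (g x)))
        (at x)" if "x \<in> W" for x
      by (intro FDERIV Ck_on_SucD[OF Suc.prems(1) that] Ck_on_SucD[OF Suc.prems(2) that])
    have "Ck_on n W (\<lambda>x. frechet_derivative f (at x) v)" "Ck_on n W (\<lambda>x. frechet_derivative g (at x) v)"
      for v using Suc.prems by auto
    then show "Ck_on n W (\<lambda>x. prod (f x) (frechet_derivative g (at x) v)
        + prod (frechet_derivative f (at x) v) (g x))" for v
      by (intro Ck_on_add assms Suc.IH Suc.prems[THEN Ck_on_Suc_imp])
  qed
qed

lemma Ck_on_Pair:
  assumes "open W" "Ck_on n W f" "Ck_on n W g"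
  shows "Ck_on n W (\<lambda>x. (f x, g x))"
proof -
  have "Ck_on n W (\<lambda>x. (f x, 0) + (0, g x))"
    by (intro Ck_on_add Ck_on_bounded_linear[where h = "\<lambda>y. (y, 0)"]
        Ck_on_bounded_linear[where h = "\<lambda>y. (0, y)"] assms bounded_linear_intros)
  then show ?thesis by simp
qed

lemma Ck_on_vec:
  fixes f :: "'n::finite \<Rightarrow> 'a::real_normed_vector \<Rightarrow> 'b::euclidean_space"
  assumes "open W" "\<And>i. Ck_on n W (f i)"
  shows "Ck_on n W (\<lambda>x. \<chi> i. f i x)"
proof -
  have "bounded_linear (axis i :: 'b \<Rightarrow> 'b^'n)" for i
    unfolding linear_conv_bounded_linear[symmetric]
    by (rule linearI) (auto simp: axis_def vec_eq_iff)
  then have "Ck_on n W (\<lambda>x. \<Sum>i\<in>UNIV. axis i (f i x))"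
    by (intro Ck_on_sum Ck_on_bounded_linear[where h = "axis _"] assms)
  moreover have "(\<Sum>i\<in>UNIV. axis i (f i x)) = (\<chi> i. f i x)" for x
    by (simp add: vec_eq_iff axis_def sum.delta)
  ultimately show ?thesis by simp
qed

section \<open>The octonions as \<open>\<complex> \<oplus> \<complex>\<^sup>3\<close>\<close>

text \<open>The octonion \<alpha> + z1 j + z2 e + z3 g, with complex scalars acting through left
  multiplication by i. The last sign is negative because i g = -h.\<close>

definition oct_of :: "complex \<Rightarrow> complex^3 \<Rightarrow> octonion" where
  "oct_of \<alpha> z = ((Re \<alpha>, Im \<alpha>, Re (z$1), Im (z$1)), (Re (z$2), Im (z$2), Re (z$3), - Im (z$3)))"

definition c_part :: "octonion \<Rightarrow> complex" where
  "c_part x = Complex (x \<bullet> oct_1) (x \<bullet> oct_i)"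

definition v_part :: "octonion \<Rightarrow> complex^3" where
  "v_part x = (\<chi> r. coord oct_i x (basis_Vi $ r))"

definition hip :: "complex^3 \<Rightarrow> complex^3 \<Rightarrow> complex" where
  "hip z w = (\<Sum>r\<in>UNIV. z$r * cnj (w$r))"

definition ccross :: "complex^3 \<Rightarrow> complex^3 \<Rightarrow> complex^3" where
  "ccross z w = vector [cnj (z$2 * w$3 - z$3 * w$2), cnj (z$3 * w$1 - z$1 * w$3),
    cnj (z$1 * w$2 - z$2 * w$1)]"

lemma basis_Vi_nth [simp]:
  "basis_Vi $ 1 = oct_j" "basis_Vi $ 2 = oct_e" "basis_Vi $ 3 = oct_g"
  by (simp_all add: basis_Vi_def)

lemma c_part_oct_of [simp]: "c_part (oct_of \<alpha> z) = \<alpha>"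
  by (simp add: c_part_def oct_of_def oct_basis_defs zero_prod_def complex_eq_iff)

lemma v_part_oct_of [simp]: "v_part (oct_of \<alpha> z) = z"
  by (simp add: v_part_def coord_def J_cx_def oct_of_def oct_basis_defs zero_prod_def
      vec_eq_iff forall_3 complex_eq_iff)

lemma oct_of_parts [simp]: "oct_of (c_part x) (v_part x) = x"
  by (cases x) (auto simp: c_part_def v_part_def coord_def J_cx_def oct_of_def oct_basis_defs
      zero_prod_def)

lemma oct_of_eq_iff [simp]: "oct_of \<alpha> z = oct_of \<beta> w \<longleftrightarrow> \<alpha> = \<beta> \<and> z = w"
  by (metis c_part_oct_of v_part_oct_of)

lemma oct_of_add: "oct_of \<alpha> z + oct_of \<beta> w = oct_of (\<alpha> + \<beta>) (z + w)"
  by (simp add: oct_of_def)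

lemma oct_of_scaleR: "t *\<^sub>R oct_of \<alpha> z = oct_of (t *\<^sub>R \<alpha>) (t *\<^sub>R z)"
  by (simp add: oct_of_def)

text \<open>The scalar \<beta> acts on z from the right through its conjugate, since i anticommutes
  with \<complex>^3.\<close>

lemma omult_oct_of:
  "oct_of \<alpha> z *\<^sub>O oct_of \<beta> w =
     oct_of (\<alpha> * \<beta> - hip z w) (\<alpha> *s w + cnj \<beta> *s z + ccross z w)"
  by (simp add: oct_of_def hip_def ccross_def sum_3 algebra_simps)

lemma oct_1_eq: "oct_1 = oct_of 1 0" and oct_i_eq: "oct_i = oct_of \<i> 0"
  by (simp_all add: oct_of_def oct_1_def oct_i_def zero_prod_def)

lemma oct_of_complex: "Re \<alpha> *\<^sub>R oct_1 + Im \<alpha> *\<^sub>R oct_i = oct_of \<alpha> 0"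
  by (simp add: oct_1_eq oct_i_eq oct_of_scaleR oct_of_add complex_eq_iff)

lemma basis_Vi_eq: "basis_Vi $ s = oct_of 0 (axis s 1)"
proof -
  have "\<forall>s. basis_Vi $ s = oct_of 0 (axis s 1)"
    by (simp add: forall_3 oct_of_def oct_basis_defs zero_prod_def axis_def)
  then show ?thesis by blast
qed

lemma hip_0 [simp]: "hip 0 w = 0" "hip z 0 = 0"
  by (simp_all add: hip_def)

lemma ccross_0 [simp]: "ccross 0 w = 0" "ccross z 0 = 0"
  by (simp_all add: ccross_def vec_eq_iff forall_3)

lemma cscale_i_oct_of: "cscale oct_i c (oct_of 0 z) = oct_of 0 (c *s z)"
  by (simp add: cscale_def J_cx_def oct_i_eq omult_oct_of oct_of_scaleR oct_of_add
      vec_eq_iff complex_eq_iff)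

lemma sum_oct_of_0: "(\<Sum>s\<in>S. oct_of 0 (f s)) = oct_of 0 (\<Sum>s\<in>S. f s)"
proof (induction S rule: infinite_finite_induct)
  case (insert x F)
  then show ?case by (simp add: oct_of_add)
qed (auto simp: oct_of_def zero_prod_def)

lemma sum_cscale_basis:
  "(\<Sum>r\<in>UNIV. cscale oct_i (z $ r) (basis_Vi $ r)) = oct_of 0 z"
  by (simp add: basis_Vi_eq cscale_i_oct_of sum_oct_of_0 basis_expansion)

lemma bounded_bilinear_omult: "bounded_bilinear (*\<^sub>O)"
proof -
  have "bilinear (*\<^sub>O)"
    unfolding bilinear_def
    by (intro conjI allI linearI; clarsimp simp: algebra_simps)
  then show ?thesis by (simp add: bilinear_conv_bounded_bilinear)
qed

section \<open>Automorphisms of the octonions\<close>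

lemma G2_D:
  assumes "\<phi> \<in> G2"
  shows "bij (blinfun_apply \<phi>)" "\<phi> (x *\<^sub>O y) = \<phi> x *\<^sub>O \<phi> y"
  using assms unfolding G2_def by blast+

lemma G2_I:
  assumes "bij (blinfun_apply \<phi>)" "\<And>x y. \<phi> (x *\<^sub>O y) = \<phi> x *\<^sub>O \<phi> y"
  shows "\<phi> \<in> G2"
  using assms unfolding G2_def by blast

text \<open>Surjectivity supplies u with image 1, whence 1 = \<phi> (1 u) = (\<phi> 1) 1 = \<phi>
  1.\<close>

lemma G2_one:
  assumes "\<phi> \<in> G2"
  shows "\<phi> oct_1 = oct_1"
proof -
  have one: "oct_1 *\<^sub>O x = x" "x *\<^sub>O oct_1 = x" for x
    by (cases x; auto simp: oct_1_def zero_prod_def)+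
  obtain u where "\<phi> u = oct_1"
    using G2_D(1)[OF assms] by (metis bij_pointE)
  then show ?thesis
    using G2_D(2)[OF assms, of oct_1 u] by (simp add: one)
qed

text \<open>
  Both \<open>x\<close> and \<open>\<phi> x\<close> satisfy a real quadratic equation whose coefficients are trace and norm.
  The image of the equation of \<open>x\<close> must be that of \<open>\<phi> x\<close>, unless \<open>\<phi> x\<close> is real.
\<close>

lemma G2_norm:
  assumes "\<phi> \<in> G2"
  shows "norm (\<phi> x) = norm x"
proof -
  have quad: "y *\<^sub>O y = (2 * (y \<bullet> oct_1)) *\<^sub>R y - (y \<bullet> y) *\<^sub>R oct_1" for y
    by (cases y) (auto simp: oct_1_def zero_prod_def algebra_simps power2_eq_square)
  let ?y = "\<phi> x"
  have "?y *\<^sub>O ?y = \<phi> (x *\<^sub>O x)"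
    by (simp add: G2_D(2)[OF assms])
  also have "\<dots> = (2 * (x \<bullet> oct_1)) *\<^sub>R ?y - (x \<bullet> x) *\<^sub>R oct_1"
    by (simp add: quad blinfun.diff_right blinfun.scaleR_right G2_one[OF assms])
  finally have eq: "(2 * (?y \<bullet> oct_1 - x \<bullet> oct_1)) *\<^sub>R ?y = (?y \<bullet> ?y - x \<bullet> x) *\<^sub>R oct_1"
    unfolding quad[of ?y] by (simp add: algebra_simps)
  have "?y \<bullet> ?y = x \<bullet> x"
  proof (cases "?y \<bullet> oct_1 = x \<bullet> oct_1")
    case True
    then show ?thesis using eq by (simp add: oct_1_def zero_prod_def)
  next
    case False
    define t where "t = (?y \<bullet> ?y - x \<bullet> x) / (2 * (?y \<bullet> oct_1 - x \<bullet> oct_1))"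
    have "?y = (1 / (2 * (?y \<bullet> oct_1 - x \<bullet> oct_1))) *\<^sub>R (2 * (?y \<bullet> oct_1 - x \<bullet> oct_1)) *\<^sub>R ?y"
      using False by simp
    also have "\<dots> = t *\<^sub>R oct_1"
      unfolding eq by (simp add: t_def)
    finally have "?y = t *\<^sub>R oct_1" .
    \<comment> \<open>Real octonions are fixed, so x and the real number t have the same image, and
      injectivity gives x = t.\<close>
    moreover have "\<phi> (t *\<^sub>R oct_1) = t *\<^sub>R oct_1"
      by (simp add: blinfun.scaleR_right G2_one[OF assms])
    ultimately have "x = ?y"
      using G2_D(1)[OF assms] by (metis bij_is_inj injD)
    then show ?thesis by simp
  qed
  then show ?thesis by (simp add: norm_eq_sqrt_inner)
qed

text \<open>Polarization of \<open>G2_norm\<close>.\<close>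

lemma G2_inner:
  assumes "\<phi> \<in> G2"
  shows "\<phi> x \<bullet> \<phi> y = x \<bullet> y"
  using G2_norm[OF assms]
  by (metis (no_types, opaque_lifting) blinfun.add_right dot_norm)

text \<open>An automorphism is an isometry and carries multiplication by \<xi> to multiplication by
  \<phi> \<xi>.\<close>

lemma G2_coord:
  assumes "\<phi> \<in> G2"
  shows "coord (\<phi> \<xi>) (\<phi> x) (\<phi> a) = coord \<xi> x a"
  by (simp add: coord_def J_cx_def G2_inner[OF assms] flip: G2_D(2)[OF assms])

lemma G2_compose: "\<phi> \<in> G2 \<Longrightarrow> \<psi> \<in> G2 \<Longrightarrow> \<phi> o\<^sub>L \<psi> \<in> G2"
  by (rule G2_I) (simp_all add: G2_D bij_comp blinfun_compose.rep_eq)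

text \<open>Linearity and multiplicativity of the inverse are tested after applying the injective
  \<phi>; boundedness is automatic in finite dimension.\<close>

lemma G2_inverse:
  assumes "\<phi> \<in> G2"
  obtains \<psi> where "\<psi> \<in> G2" "\<And>x. \<psi> (\<phi> x) = x" "\<And>x. \<phi> (\<psi> x) = x"
proof -
  let ?g = "inv (blinfun_apply \<phi>)"
  have bij: "bij (blinfun_apply \<phi>)" by (rule G2_D(1)[OF assms])
  have inv: "?g (\<phi> x) = x" "\<phi> (?g x) = x" for x
    using bij by (simp_all add: bij_is_inj bij_is_surj surj_f_inv_f)
  have "linear ?g"
    by (rule linearI; rule injD[OF bij_is_inj[OF bij]])
      (simp_all add: inv blinfun.add_right blinfun.scaleR_right)
  then have app: "blinfun_apply (Blinfun ?g) = ?g"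
    by (simp add: bounded_linear_Blinfun_apply linear_conv_bounded_linear)
  have "?g (x *\<^sub>O y) = ?g x *\<^sub>O ?g y" for x y
    by (rule injD[OF bij_is_inj[OF bij]]) (simp add: inv G2_D(2)[OF assms])
  then have "Blinfun ?g \<in> G2"
    by (intro G2_I) (simp_all only: app bij bij_imp_bij_inv)
  then show thesis using that[of "Blinfun ?g"] by (simp add: app inv)
qed

text \<open>This is \<tau>: as k = i j, f = i e, g = j e and h = k e, exactly i, k, f and h change
  sign.\<close>

definition oct_flip :: "octonion \<Rightarrow>\<^sub>L octonion" where
  "oct_flip = Blinfun (\<lambda>((a, b, c, d), (a', b', c', d')). ((a, - b, c, - d), (a', - b', c', - d')))"

lemma oct_flip_apply:
  "oct_flip ((a, b, c, d), (a', b', c', d')) = ((a, - b, c, - d), (a', - b', c', - d'))"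
proof -
  have "linear (\<lambda>((a, b, c, d), (a', b', c', d')). ((a, - b, c, - d), (a', - b', c', - d'))
      :: octonion)"
    by (rule linearI) auto
  then show ?thesis
    by (simp add: oct_flip_def bounded_linear_Blinfun_apply linear_conv_bounded_linear)
qed

lemma oct_flip_in_G2: "oct_flip \<in> G2"
proof -
  have "oct_flip (oct_flip x) = x" for x
    by (cases x) (auto simp: oct_flip_apply)
  then have "bij (blinfun_apply oct_flip)"
    by (rule involuntory_imp_bij)
  moreover have "oct_flip (x *\<^sub>O y) = oct_flip x *\<^sub>O oct_flip y" for x y
    by (cases x; cases y) (auto simp: oct_flip_apply)
  ultimately show ?thesis by (rule G2_I)
qed

lemma oct_flip_i: "oct_flip oct_i = - oct_i"
  by (simp add: oct_i_def oct_flip_apply zero_prod_def)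

lemma oct_flip_basis: "oct_flip (basis_Vi $ s) = basis_Vi $ s"
proof -
  have "\<forall>s. oct_flip (basis_Vi $ s) = basis_Vi $ s"
    by (simp add: forall_3 oct_basis_defs zero_prod_def oct_flip_apply)
  then show ?thesis by blast
qed

section \<open>The stabilizer of \<open>i\<close> and \<open>SU(3)\<close>\<close>

lemma matrix_vector_mult_axis: "(A :: complex^'n^'m) *v axis s 1 = column s A"
  by (simp add: vec_eq_iff matrix_vector_mult_def column_def axis_def if_distrib sum.delta
      cong: if_cong)

lemma hip_matrix_vector_mult: "hip (A *v z) w = hip z (cadjoint A *v w)"
  by (simp add: hip_def matrix_vector_mult_def cadjoint_def sum_3 algebra_simps)

text \<open>The conjugations in \<open>hip\<close> and \<open>ccross\<close> cancel, so their
  combination is the complex volume form, the determinant with rows u, z, w. Applying A to each row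
  is right multiplication by the transpose of A.\<close>

lemma hip_ccross_matrix_vector_mult:
  "hip (A *v u) (ccross (A *v z) (A *v w)) = det A * hip u (ccross z w)"
proof -
  have triple: "hip x (ccross y v) = det (vector [x, y, v])" for x y v
    by (simp add: hip_def ccross_def det_3 sum_3 algebra_simps)
  have "(vector [A *v u, A *v z, A *v w] :: complex^3^3) = vector [u, z, w] ** transpose A"
    by (simp add: vec_eq_iff forall_3 matrix_matrix_mult_def matrix_vector_mult_def transpose_def
        sum_3 mult.commute)
  then show ?thesis by (simp add: triple det_mul det_transpose mult.commute)
qed

lemma hip_self_eq_0: "hip z z = 0 \<longleftrightarrow> z = 0"
proof -
  have "hip z z = complex_of_real (\<Sum>r\<in>UNIV. (cmod (z$r))\<^sup>2)"
    by (simp add: hip_def complex_norm_square flip: of_real_power)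
  then show ?thesis
    by (simp add: sum_nonneg_eq_0_iff vec_eq_iff del: of_real_sum)
qed

lemma hip_diff_right: "hip u (x - y) = hip u x - hip u y"
  by (simp add: hip_def right_diff_distrib sum_subtractf)

lemma SU3_hip:
  assumes "A \<in> SU3"
  shows "hip (A *v z) (A *v w) = hip z w"
  using assms by (simp add: hip_matrix_vector_mult SU3_def matrix_vector_mul_assoc)

text \<open>As det A = 1, both sides have the same Hermitian product with every vector A u, and
  these exhaust \<complex>^3.\<close>

lemma SU3_ccross:
  assumes "A \<in> SU3"
  shows "ccross (A *v z) (A *v w) = A *v ccross z w"
proof -
  let ?d = "ccross (A *v z) (A *v w) - A *v ccross z w"
  have "hip (A *v u) ?d = 0" for u
    using assms by (simp add: hip_diff_right hip_ccross_matrix_vector_mult SU3_hip SU3_def)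
  \<comment> \<open>This choice of u makes A u the difference itself.\<close>
  from this[of "cadjoint A *v ?d"] have "hip ?d ?d = 0"
    using assms by (simp add: SU3_def matrix_vector_mul_assoc)
  then show ?thesis by (simp add: hip_self_eq_0)
qed

section \<open>From special unitary matrices to the stabilizer\<close>

definition of_SU3 :: "complex^3^3 \<Rightarrow> octonion \<Rightarrow>\<^sub>L octonion" where
  "of_SU3 A = Blinfun (\<lambda>x. oct_of (c_part x) (A *v v_part x))"

lemma linear_c_part: "linear c_part"
  by (rule linearI) (simp_all add: c_part_def inner_add_left complex_eq_iff)

lemma linear_v_part: "linear v_part"
  by (rule linearI)
    (simp_all add: v_part_def coord_def inner_add_left vec_eq_iff complex_eq_iff)

lemma linear_oct_of:
  assumes "linear f" "linear g"
  shows "linear (\<lambda>x. oct_of (f x) (g x))"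
  by (rule linearI)
    (simp_all add: linear_add[OF assms(1)] linear_add[OF assms(2)] linear_scale[OF assms(1)]
      linear_scale[OF assms(2)] oct_of_add oct_of_scaleR)

lemma linear_matrix_v_part: "linear (\<lambda>x. A *v v_part x)"
  by (rule linearI)
    (simp_all add: linear_add[OF linear_v_part] linear_scale[OF linear_v_part] vec_eq_iff
      matrix_vector_mult_def distrib_left sum.distrib scaleR_sum_right)

lemma of_SU3_apply: "of_SU3 A x = oct_of (c_part x) (A *v v_part x)"
  unfolding of_SU3_def
  by (subst bounded_linear_Blinfun_apply)
    (simp_all add: linear_oct_of linear_c_part linear_matrix_v_part flip: linear_conv_bounded_linear)

lemma of_SU3_oct_of [simp]: "of_SU3 A (oct_of \<alpha> z) = oct_of \<alpha> (A *v z)"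
  by (simp add: of_SU3_apply)

lemma matrix_vector_mult_vmult: "(A :: complex^'n^'m) *v (c *s z) = c *s (A *v z)"
  by (simp add: vec_eq_iff matrix_vector_mult_def sum_distrib_left mult.left_commute)

text \<open>The product of \<complex> \<oplus> \<complex>^3 is built from scalar multiplication,
  \<open>hip\<close> and \<open>ccross\<close>, all respected by A; the adjoint provides the
  inverse.\<close>

lemma of_SU3_in_stab_K:
  assumes "A \<in> SU3"
  shows "of_SU3 A \<in> stab_K"
proof -
  have A: "A ** cadjoint A = mat 1" "cadjoint A ** A = mat 1"
    using assms by (auto simp: SU3_def)
  have "of_SU3 (cadjoint A) (of_SU3 A x) = x" "of_SU3 A (of_SU3 (cadjoint A) x) = x" for x
    by (simp_all add: of_SU3_apply matrix_vector_mul_assoc A)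
  then have "bij (blinfun_apply (of_SU3 A))"
    by (metis bijI')
  moreover have "of_SU3 A (x *\<^sub>O y) = of_SU3 A x *\<^sub>O of_SU3 A y" for x y
  proof -
    obtain \<alpha> z \<beta> w where "x = oct_of \<alpha> z" "y = oct_of \<beta> w"
      by (metis oct_of_parts)
    then show ?thesis
      by (simp add: omult_oct_of SU3_hip[OF assms] SU3_ccross[OF assms]
          matrix_vector_right_distrib matrix_vector_mult_vmult)
  qed
  ultimately have "of_SU3 A \<in> G2" by (rule G2_I)
  then show ?thesis
    by (simp add: stab_K_def preim_p_def p_G2_def oct_i_eq)
qed

text \<open>Common form of two matrices: \<open>theta\<close> is the case P = Q \<xi>, and the
  matrix of a stabilizer element is the case \<xi> = i with P the identity.\<close>

definition frame_matrix ::
  "octonion \<Rightarrow> (octonion \<Rightarrow>\<^sub>L octonion) \<Rightarrow> (octonion \<Rightarrow>\<^sub>L octonion) \<Rightarrow> complex^3^3" where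
  "frame_matrix \<xi> P \<phi> = (\<chi> r s. coord \<xi> (\<phi> (basis_Vi $ s)) (P (basis_Vi $ r)))"

section \<open>From the stabilizer to special unitary matrices\<close>

abbreviation "coord_matrix \<equiv> frame_matrix oct_i id_blinfun"

lemma column_coord_matrix: "column s (coord_matrix \<Phi>) = v_part (\<Phi> (basis_Vi $ s))"
  by (simp add: frame_matrix_def column_def v_part_def)

lemma stab_K_D:
  assumes "\<Phi> \<in> stab_K"
  shows "\<Phi> \<in> G2" "\<Phi> oct_i = oct_i"
  using assms by (auto simp: stab_K_def preim_p_def p_G2_def)

text \<open>The summand \<open>\<complex>\<^sup>3\<close> consists of the octonions that anticommute with \<open>i\<close>.\<close>

lemma stab_K_basis:
  assumes "\<Phi> \<in> stab_K"
  shows "\<Phi> (basis_Vi $ s) = oct_of 0 (column s (coord_matrix \<Phi>))"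
proof -
  have anti: "x *\<^sub>O oct_i = - (oct_i *\<^sub>O x) \<longleftrightarrow> c_part x = 0" for x
  proof -
    obtain \<alpha> z where x: "x = oct_of \<alpha> z" by (metis oct_of_parts)
    have "- oct_of \<beta> w = oct_of (- \<beta>) (- w)" for \<beta> w by (simp add: oct_of_def)
    then show ?thesis
      by (auto simp: x oct_i_eq omult_oct_of vec_eq_iff eq_neg_iff_add_eq_0 complex_eq_iff)
  qed
  have "basis_Vi $ s *\<^sub>O oct_i = - (oct_i *\<^sub>O basis_Vi $ s)"
    by (simp add: anti basis_Vi_eq)
  then have "\<Phi> (basis_Vi $ s) *\<^sub>O oct_i = - (oct_i *\<^sub>O \<Phi> (basis_Vi $ s))"
    using G2_D(2)[OF stab_K_D(1)[OF assms]] stab_K_D(2)[OF assms]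
    by (metis blinfun.minus_right)
  then have "c_part (\<Phi> (basis_Vi $ s)) = 0" by (simp add: anti)
  then show ?thesis by (metis column_coord_matrix oct_of_parts)
qed

text \<open>Fixing 1 and i makes \<Phi> commute with left multiplication by i. Hence it is complex
  linear and determined by the images of j, e, g.\<close>

lemma stab_K_oct_of:
  assumes "\<Phi> \<in> stab_K"
  shows "\<Phi> (oct_of \<alpha> z) = oct_of \<alpha> (coord_matrix \<Phi> *v z)"
proof -
  note G = stab_K_D(1)[OF assms] and i = stab_K_D(2)[OF assms]
  have "oct_of \<alpha> z = (Re \<alpha> *\<^sub>R oct_1 + Im \<alpha> *\<^sub>R oct_i)
      + (\<Sum>s\<in>UNIV. cscale oct_i (z $ s) (basis_Vi $ s))" for \<alpha> z
    by (simp add: sum_cscale_basis oct_of_complex oct_of_add)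
  note decomp = this
  have "\<Phi> (oct_of \<alpha> z) = (Re \<alpha> *\<^sub>R oct_1 + Im \<alpha> *\<^sub>R oct_i)
      + (\<Sum>s\<in>UNIV. cscale oct_i (z $ s) (\<Phi> (basis_Vi $ s)))"
    by (subst decomp)
      (simp add: blinfun.add_right blinfun.scaleR_right blinfun.sum_right cscale_def J_cx_def
        G2_D(2)[OF G] G2_one[OF G] i)
  also have "\<dots> = oct_of \<alpha> 0 + oct_of 0 (coord_matrix \<Phi> *v z)"
    by (simp add: stab_K_basis[OF assms] cscale_i_oct_of sum_oct_of_0 matrix_mult_sum
        oct_of_complex)
  finally show ?thesis by (simp add: oct_of_add)
qed

lemma coord_matrix_of_SU3 [simp]: "coord_matrix (of_SU3 A) = A"
proof -
  have "column s (coord_matrix (of_SU3 A)) = column s A" for s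
    by (simp add: column_coord_matrix basis_Vi_eq matrix_vector_mult_axis)
  then show ?thesis by (simp add: vec_eq_iff column_def)
qed

lemma of_SU3_coord_matrix: "\<Phi> \<in> stab_K \<Longrightarrow> of_SU3 (coord_matrix \<Phi>) = \<Phi>"
  by (rule blinfun_eqI) (metis stab_K_oct_of of_SU3_oct_of oct_of_parts)

text \<open>
  Comparing the two sides of \<open>\<Phi> (x y) = \<Phi> x \<Phi> y\<close> in the model \<open>\<complex> \<oplus> \<complex>\<^sup>3\<close> shows that the matrix
  preserves both the Hermitian form and the conjugated cross product.
\<close>

lemma coord_matrix_in_SU3:
  assumes "\<Phi> \<in> stab_K"
  shows "coord_matrix \<Phi> \<in> SU3"
proof -
  define M where "M = coord_matrix \<Phi>"
  have "\<Phi> (oct_of 0 z *\<^sub>O oct_of 0 w) = \<Phi> (oct_of 0 z) *\<^sub>O \<Phi> (oct_of 0 w)" for z w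
    by (rule G2_D(2)[OF stab_K_D(1)[OF assms]])
  then have hip: "hip (M *v z) (M *v w) = hip z w"
    and cross: "ccross (M *v z) (M *v w) = M *v ccross z w" for z w
    by (simp_all add: omult_oct_of stab_K_oct_of[OF assms] M_def)
  have hip_axis: "hip (axis r 1) w = cnj (w $ r)" for r w
    by (simp add: hip_def axis_def if_distrib[of "\<lambda>x. x * _"] sum.delta cong: if_cong)
  have "(cadjoint M ** M) *v axis s 1 = axis s 1" for s
  proof -
    have "hip (axis r 1) (cadjoint M ** M *v axis s 1) = hip (axis r 1) (axis s 1)" for r
      using hip[of "axis r 1" "axis s 1"]
      by (simp add: hip_matrix_vector_mult matrix_vector_mul_assoc)
    then show ?thesis by (simp add: hip_axis vec_eq_iff)
  qed
  then have "column s (cadjoint M ** M) = column s (mat 1)" for s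
    by (metis matrix_vector_mult_axis matrix_vector_mul_lid)
  then have 1: "cadjoint M ** M = mat 1" by (simp add: vec_eq_iff column_def)
  then have 2: "M ** cadjoint M = mat 1" by (simp add: matrix_left_right_inverse)
  \<comment> \<open>The volume form has value 1 at these three axes. Applying M multiplies it by det
    M, yet leaves it unchanged because M preserves \<open>hip\<close> and
    \<open>ccross\<close>.\<close>
  have ax: "ccross (axis 1 1) (axis 2 1) = axis 3 1" "hip (axis 3 1) (axis 3 1) = 1"
    by (simp_all add: ccross_def hip_def axis_def vec_eq_iff forall_3 sum_3)
  have "det M = 1"
    using hip_ccross_matrix_vector_mult[of M "axis 3 1" "axis 1 1" "axis 2 1"]
    by (simp add: cross ax hip)
  with 1 2 show ?thesis by (simp add: SU3_def M_def)
qed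

section \<open>The identification \<open>mat_K\<close> and the right action\<close>

lemma mat_K_eq:
  assumes "\<Phi> \<in> stab_K"
  shows "mat_K \<Phi> = coord_matrix \<Phi>"
  unfolding mat_K_def
proof (rule the_equality)
  have eq: "(\<Sum>r\<in>UNIV. cscale oct_i (M $ r $ s) (basis_Vi $ r)) = oct_of 0 (column s M)" for M s
    using sum_cscale_basis[of "column s M"] by (simp add: column_def)
  show "\<forall>s. \<Phi> (basis_Vi $ s)
      = (\<Sum>r\<in>UNIV. cscale oct_i (coord_matrix \<Phi> $ r $ s) (basis_Vi $ r))"
    unfolding eq by (simp add: stab_K_basis[OF assms])
  \<comment> \<open>Uniqueness for the description in \<open>mat_K\<close>: \<open>oct_of\<close> is
    injective, so the images of the basis determine the columns.\<close>
  show "M = coord_matrix \<Phi>"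
    if "\<forall>s. \<Phi> (basis_Vi $ s) = (\<Sum>r\<in>UNIV. cscale oct_i (M $ r $ s) (basis_Vi $ r))" for M
    using that unfolding eq
    by (simp add: stab_K_basis[OF assms]) (simp add: vec_eq_iff column_def)
qed

text \<open>Turns the abstract action \<open>act_SU3\<close> into composition with
  \<open>of_SU3 A\<close>.\<close>

lemma inv_into_mat_K:
  assumes "A \<in> SU3"
  shows "inv_into stab_K mat_K A = of_SU3 A"
proof (rule inv_into_f_eq)
  show "inj_on mat_K stab_K"
    by (rule inj_onI) (metis mat_K_eq of_SU3_coord_matrix)
qed (simp_all add: of_SU3_in_stab_K[OF assms] mat_K_eq)

text \<open>The source of equivariance: composition in the stabilizer becomes the matrix
  product.\<close>

lemma coord_matrix_compose:
  assumes "\<Phi> \<in> stab_K"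
  shows "coord_matrix (\<Phi> o\<^sub>L of_SU3 A) = coord_matrix \<Phi> ** A"
proof -
  have "column s (coord_matrix (\<Phi> o\<^sub>L of_SU3 A)) = column s (coord_matrix \<Phi> ** A)" for s
    unfolding column_coord_matrix
    by (simp add: basis_Vi_eq stab_K_oct_of[OF assms] matrix_vector_mul_assoc flip: matrix_vector_mult_axis)
  then show ?thesis by (simp add: vec_eq_iff column_def)
qed

lemma smooth_of_SU3: "Ck_on n UNIV of_SU3"
proof -
  \<comment> \<open>\<open>of_SU3\<close> is affine in A, not linear: \<open>of_SU3 0\<close> is the
    projection onto the summand \<complex>.\<close>
  define L where "L A = of_SU3 A - of_SU3 0" for A
  have "linear L"
  proof (rule linearI; rule blinfun_eqI)
    have L: "L A x = oct_of 0 (A *v v_part x)" for A x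
      by (simp add: L_def blinfun.diff_left of_SU3_apply oct_of_def)
    show "L (A + B) x = (L A + L B) x" for A B x
      by (simp add: L blinfun.add_left oct_of_add matrix_vector_mult_add_rdistrib)
    show "L (c *\<^sub>R A) x = (c *\<^sub>R L A) x" for c A x
      by (simp add: L blinfun.scaleR_left oct_of_scaleR)
        (simp add: vec_eq_iff matrix_vector_mult_def scaleR_sum_right)
  qed
  then have L: "bounded_linear L" by (simp add: linear_conv_bounded_linear)
  have "Ck_on n UNIV (\<lambda>A. L A + of_SU3 0)"
    by (intro Ck_on_add Ck_on_linear[OF _ L] Ck_on_const) auto
  then show ?thesis by (simp add: L_def)
qed

section \<open>The trivialization\<close>

text \<open>The third columns agree because g = j e and \<phi> is multiplicative.\<close>

lemma theta_eq_frame_matrix: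
  assumes "\<phi> \<in> G2"
  shows "theta Q \<xi> \<phi> = frame_matrix \<xi> (Q \<xi>) \<phi>"
  by (simp add: theta_def frame_matrix_def Let_def vec_eq_iff forall_3 oct_g_def G2_D(2)[OF assms])

lemma frame_matrix_flip: "frame_matrix \<xi> (P o\<^sub>L oct_flip) \<phi> = frame_matrix \<xi> P \<phi>"
  by (simp add: frame_matrix_def oct_flip_basis)

text \<open>Undoing the automorphism P by \<open>G2_coord\<close> moves the base point back to
  \<xi>; at \<xi> = i this gives the matrix of a stabilizer element.\<close>

lemma frame_matrix_compose:
  assumes "P \<in> G2"
  shows "frame_matrix (P \<xi>) P (P o\<^sub>L \<phi>) = frame_matrix \<xi> id_blinfun \<phi>"
  by (simp add: frame_matrix_def G2_coord[OF assms])

text \<open>F plays the role of a local extension of Q to the ambient space. Everything else is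
  evaluation, octonion product and inner product, hence linear or bilinear.\<close>

lemma smooth_frame_matrix:
  assumes "open W" "\<And>n. Ck_on n W F"
  shows "Ck_on n ((\<lambda>\<phi>. blinfun_apply \<phi> oct_i) -` W)
    (\<lambda>\<phi>. (blinfun_apply \<phi> oct_i, frame_matrix (\<phi> oct_i) (F (\<phi> oct_i)) \<phi>))"
proof -
  let ?V = "(\<lambda>\<phi>. blinfun_apply \<phi> oct_i) -` W"
  note ev = blinfun.bounded_linear_left
  have V: "open ?V"
    by (rule continuous_open_vimage) (auto intro: continuous_intros assms)
  have F: "Ck_on n ?V (\<lambda>\<phi>. F (\<phi> oct_i))"
    by (rule Ck_on_compose_bounded_linear[OF assms(1) ev assms(2)])
  have Fb: "Ck_on n ?V (\<lambda>\<phi>. F (\<phi> oct_i) b)" for b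
    by (rule Ck_on_bounded_linear[OF V ev F])
  have of_real: "bounded_linear (\<lambda>x. complex_of_real x)" "bounded_linear (\<lambda>x. \<i> * complex_of_real x)"
    by (auto intro: bounded_linear_intros bounded_linear_of_real)
  show ?thesis
    unfolding frame_matrix_def coord_def J_cx_def
    by (intro Ck_on_Pair Ck_on_vec Ck_on_add V
        Ck_on_bounded_linear[OF V of_real(1)] Ck_on_bounded_linear[OF V of_real(2)]
        bounded_bilinear.Ck_on[OF bounded_bilinear_inner]
        bounded_bilinear.Ck_on[OF bounded_bilinear_omult]
        Fb Ck_on_linear[OF V ev])
qed

text \<open>Stated for arbitrary Q, so that inserting a local extension of the given Q extends the
  inverse to the ambient space.\<close>

definition psi2_inverse ::
  "(octonion \<Rightarrow> octonion \<Rightarrow>\<^sub>L octonion) \<Rightarrow> octonion \<times> (complex^3^3) \<Rightarrow> (octonion \<Rightarrow>\<^sub>L octonion)" where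
  "psi2_inverse Q = (\<lambda>(\<xi>, A). (Q \<xi> o\<^sub>L oct_flip) o\<^sub>L of_SU3 A)"

lemma smooth_psi2_inverse:
  assumes "open W" "\<And>n. Ck_on n W F"
  shows "Ck_on n (W \<times> UNIV) (psi2_inverse F)"
proof -
  have W: "W \<times> UNIV = fst -` W"
    by auto
  have open_W: "open (W \<times> (UNIV :: (complex^3^3) set))"
    using assms(1) by (simp add: open_Times)
  have 1: "Ck_on n (W \<times> UNIV) (\<lambda>x :: octonion \<times> (complex^3^3). F (fst x))"
    unfolding W by (rule Ck_on_compose_bounded_linear[OF assms(1) bounded_linear_fst assms(2)])
  have "Ck_on n (snd -` UNIV) (\<lambda>x :: octonion \<times> (complex^3^3). of_SU3 (snd x))"
    by (rule Ck_on_compose_bounded_linear[OF open_UNIV bounded_linear_snd smooth_of_SU3])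
  then have 2: "Ck_on n (W \<times> UNIV) (\<lambda>x :: octonion \<times> (complex^3^3). of_SU3 (snd x))"
    by (rule Ck_on_subset) simp
  show ?thesis
    unfolding psi2_inverse_def case_prod_beta
    by (intro bounded_bilinear.Ck_on[OF bounded_bilinear_blinfun_compose] Ck_on_const open_W 1 2)
qed

theorem proposition3p4:
  fixes Q :: "octonion \<Rightarrow> (octonion \<Rightarrow>\<^sub>L octonion)"
  assumes "\<forall>\<xi>\<in>U2. Q \<xi> \<in> G2"
    and "smooth_map_on U2 Q"
    and "\<forall>\<xi>\<in>U2. Q \<xi> (- oct_i) = \<xi>"
  shows "(\<forall>\<xi>\<in>U2. \<forall>\<phi>\<in>preim_p {\<xi>}. theta Q \<xi> \<phi> \<in> SU3) \<and> local_trivialization U2 (psi2 Q)"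
proof -
  define P where "P \<xi> = Q \<xi> o\<^sub>L oct_flip" for \<xi>
  have P: "P \<xi> \<in> G2" "P \<xi> oct_i = \<xi>" if "\<xi> \<in> U2" for \<xi>
    using assms(1,3) that by (simp_all add: P_def G2_compose oct_flip_in_G2 oct_flip_i)
  \<comment> \<open>Since \<tau> fixes j, e and g, the frame of Q \<xi> is that of P \<xi>, which is
    then moved back to the standard frame at i.\<close>
  have theta_P: "theta Q \<xi> (P \<xi> o\<^sub>L \<Phi>) = coord_matrix \<Phi>" if "\<xi> \<in> U2" "\<Phi> \<in> stab_K" for \<xi> \<Phi>
    using frame_matrix_compose[OF P(1)[OF that(1)], of oct_i \<Phi>] that
    by (simp add: theta_eq_frame_matrix G2_compose P stab_K_D frame_matrix_flip[of \<xi> "Q \<xi>", symmetric]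
        flip: P_def)
  \<comment> \<open>Two automorphisms with the same value at i differ by a stabilizer element, here
    the inverse of P (\<phi> i) followed after \<phi>.\<close>
  have factor: "\<exists>\<Phi>\<in>stab_K. \<phi> = P (\<phi> oct_i) o\<^sub>L \<Phi>" if \<phi>: "\<phi> \<in> preim_p U2" for \<phi>
  proof -
    have \<phi>': "\<phi> \<in> G2" "\<phi> oct_i \<in> U2" using \<phi> by (auto simp: preim_p_def p_G2_def)
    obtain R where R: "R \<in> G2" "\<And>x. R (P (\<phi> oct_i) x) = x" "\<And>x. P (\<phi> oct_i) (R x) = x"
      using G2_inverse[OF P(1)[OF \<phi>'(2)]] by blast
    have "R (\<phi> oct_i) = oct_i" using R(2)[of oct_i] P(2)[OF \<phi>'(2)] by simp
    then have "R o\<^sub>L \<phi> \<in> stab_K"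
      by (simp add: stab_K_def preim_p_def p_G2_def G2_compose R \<phi>')
    moreover have "\<phi> = P (\<phi> oct_i) o\<^sub>L (R o\<^sub>L \<phi>)" by (rule blinfun_eqI) (simp add: R)
    ultimately show ?thesis by blast
  qed
  have P_preim: "P \<xi> o\<^sub>L \<Phi> \<in> preim_p U2" "(P \<xi> o\<^sub>L \<Phi>) oct_i = \<xi>"
    if "\<xi> \<in> U2" "\<Phi> \<in> stab_K" for \<xi> \<Phi>
    using that by (simp_all add: preim_p_def p_G2_def G2_compose P stab_K_D)
  have theta_SU3: "theta Q (\<phi> oct_i) \<phi> \<in> SU3" if \<phi>: "\<phi> \<in> preim_p U2" for \<phi>
  proof -
    obtain \<Phi> where \<Phi>: "\<Phi> \<in> stab_K" "\<phi> = P (\<phi> oct_i) o\<^sub>L \<Phi>" using factor[OF \<phi>] by blast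
    have "\<phi> oct_i \<in> U2" using \<phi> by (simp add: preim_p_def p_G2_def)
    then show ?thesis using theta_P[OF _ \<Phi>(1)] \<Phi> coord_matrix_in_SU3 by metis
  qed
  have inv_psi: "psi2_inverse Q (psi2 Q \<phi>) = \<phi>" if \<phi>: "\<phi> \<in> preim_p U2" for \<phi>
  proof -
    obtain \<Phi> where \<Phi>: "\<Phi> \<in> stab_K" "\<phi> = P (\<phi> oct_i) o\<^sub>L \<Phi>" using factor[OF \<phi>] by blast
    have "\<phi> oct_i \<in> U2" using \<phi> by (simp add: preim_p_def p_G2_def)
    then have "theta Q (\<phi> oct_i) \<phi> = coord_matrix \<Phi>" using theta_P[OF _ \<Phi>(1)] \<Phi>(2) by metis
    then have "psi2_inverse Q (psi2 Q \<phi>) = P (\<phi> oct_i) o\<^sub>L \<Phi>"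
      by (simp add: psi2_def psi2_inverse_def p_G2_def of_SU3_coord_matrix[OF \<Phi>(1)] P_def)
    then show ?thesis using \<Phi>(2) by simp
  qed
  have psi_inv: "psi2 Q (psi2_inverse Q (\<xi>, A)) = (\<xi>, A)" "psi2_inverse Q (\<xi>, A) \<in> preim_p U2"
    if "\<xi> \<in> U2" "A \<in> SU3" for \<xi> A
  proof -
    have eq: "psi2_inverse Q (\<xi>, A) = P \<xi> o\<^sub>L of_SU3 A" by (simp add: psi2_inverse_def P_def)
    note K = of_SU3_in_stab_K[OF that(2)]
    show "psi2 Q (psi2_inverse Q (\<xi>, A)) = (\<xi>, A)"
      using P_preim(2)[OF that(1) K] theta_P[OF that(1) K]
      by (simp add: eq psi2_def p_G2_def del: blinfun_apply_blinfun_compose)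
    show "psi2_inverse Q (\<xi>, A) \<in> preim_p U2" using P_preim(1)[OF that(1) K] by (simp add: eq)
  qed

  \<comment> \<open>Bijectivity, and smoothness in both directions\<close>
  have bij: "bij_betw (psi2 Q) (preim_p U2) (U2 \<times> SU3)"
  proof (rule bij_betw_byWitness[where f' = "psi2_inverse Q"])
    show "psi2 Q ` preim_p U2 \<subseteq> U2 \<times> SU3"
      using theta_SU3 by (auto simp: psi2_def p_G2_def preim_p_def)
  qed (use inv_psi psi_inv in auto)
  have smooth: "smooth_map_on (preim_p U2) (psi2 Q)"
    unfolding smooth_map_on_def
  proof
    fix \<phi> assume "\<phi> \<in> preim_p U2"
    then have "\<phi> oct_i \<in> U2" by (simp add: preim_p_def p_G2_def)
    then obtain W F where W: "open W" "\<phi> oct_i \<in> W" "\<And>n. Ck_on n W F" "\<forall>y\<in>U2 \<inter> W. F y = Q y"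
      using assms(2) unfolding smooth_map_on_def by metis
    let ?V = "(\<lambda>\<phi>. blinfun_apply \<phi> oct_i) -` W"
    let ?G = "\<lambda>\<phi>. (blinfun_apply \<phi> oct_i, frame_matrix (\<phi> oct_i) (F (\<phi> oct_i)) \<phi>)"
    have "open ?V" by (rule continuous_open_vimage) (auto intro: continuous_intros W)
    \<comment> \<open>Agreement uses that \<rho> is an automorphism: \<open>?G\<close> contains
      \<rho> g where \<open>psi2\<close> has the product of \<rho> j and \<rho> e.\<close>
    moreover have "\<forall>\<rho>\<in>preim_p U2 \<inter> ?V. ?G \<rho> = psi2 Q \<rho>"
      using W(4) by (auto simp: psi2_def p_G2_def preim_p_def theta_eq_frame_matrix)
    ultimately show "\<exists>V G. open V \<and> \<phi> \<in> V \<and> (\<forall>n. Ck_on n V G) \<and> (\<forall>\<rho>\<in>preim_p U2 \<inter> V. G \<rho> = psi2 Q \<rho>)"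
      using W(2) smooth_frame_matrix[OF W(1,3)] by (intro exI[of _ ?V] exI[of _ ?G]) auto
  qed
  have inv_into: "inv_into (preim_p U2) (psi2 Q) x = psi2_inverse Q x" if "x \<in> U2 \<times> SU3" for x
    using that psi_inv bij by (intro inv_into_f_eq) (auto simp: bij_betw_def)
  have smooth_inv: "smooth_map_on (U2 \<times> SU3) (inv_into (preim_p U2) (psi2 Q))"
    unfolding smooth_map_on_def
  proof
    fix x assume "x \<in> U2 \<times> SU3"
    then have "fst x \<in> U2" by auto
    then obtain W F where W: "open W" "fst x \<in> W" "\<And>n. Ck_on n W F" "\<forall>y\<in>U2 \<inter> W. F y = Q y"
      using assms(2) unfolding smooth_map_on_def by metis
    have "\<forall>y\<in>(U2 \<times> SU3) \<inter> (W \<times> UNIV). psi2_inverse F y = inv_into (preim_p U2) (psi2 Q) y"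
    proof
      fix y assume y: "y \<in> (U2 \<times> SU3) \<inter> (W \<times> UNIV)"
      then have "psi2_inverse F y = psi2_inverse Q y" using W(4) by (auto simp: psi2_inverse_def)
      then show "psi2_inverse F y = inv_into (preim_p U2) (psi2 Q) y" using inv_into y by auto
    qed
    then show "\<exists>V G. open V \<and> x \<in> V \<and> (\<forall>n. Ck_on n V G)
        \<and> (\<forall>y\<in>(U2 \<times> SU3) \<inter> V. G y = inv_into (preim_p U2) (psi2 Q) y)"
      using W(1,2) smooth_psi2_inverse[OF W(1,3)]
      by (intro exI[of _ "W \<times> UNIV"] exI[of _ "psi2_inverse F"]) (auto simp: open_Times mem_Times_iff)
  qed

  \<comment> \<open>Equivariance\<close>
  have act: "psi2 Q (act_SU3 \<phi> A) = (fst (psi2 Q \<phi>), snd (psi2 Q \<phi>) ** A)"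
    if \<phi>: "\<phi> \<in> preim_p U2" and A: "A \<in> SU3" for \<phi> A
  proof -
    obtain \<Phi> where \<Phi>: "\<Phi> \<in> stab_K" "\<phi> = P (\<phi> oct_i) o\<^sub>L \<Phi>" using factor[OF \<phi>] by blast
    define \<xi> where "\<xi> = \<phi> oct_i"
    have \<xi>: "\<xi> \<in> U2" using \<phi> by (simp add: \<xi>_def preim_p_def p_G2_def)
    have \<phi>_eq: "\<phi> = P \<xi> o\<^sub>L \<Phi>" using \<Phi>(2) by (simp add: \<xi>_def)
    note LA = of_SU3_in_stab_K[OF A]
    have K: "\<Phi> o\<^sub>L of_SU3 A \<in> stab_K"
      using stab_K_D[OF \<Phi>(1)] stab_K_D[OF LA]
      by (simp add: stab_K_def preim_p_def p_G2_def G2_compose)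
    \<comment> \<open>The action only multiplies the stabilizer factor \<Phi> on the right; the
      section value P \<xi> stays.\<close>
    have "act_SU3 \<phi> A = P \<xi> o\<^sub>L (\<Phi> o\<^sub>L of_SU3 A)"
      by (rule blinfun_eqI) (simp add: act_SU3_def inv_into_mat_K[OF A] \<phi>_eq)
    then have "psi2 Q (act_SU3 \<phi> A) = (\<xi>, coord_matrix \<Phi> ** A)"
      using P_preim(2)[OF \<xi> K] theta_P[OF \<xi> K]
      by (simp add: psi2_def p_G2_def coord_matrix_compose[OF \<Phi>(1)] del: blinfun_apply_blinfun_compose)
    moreover have "psi2 Q \<phi> = (\<xi>, coord_matrix \<Phi>)"
      using P_preim(2)[OF \<xi> \<Phi>(1)] theta_P[OF \<xi> \<Phi>(1)]
      by (simp add: psi2_def p_G2_def \<phi>_eq del: blinfun_apply_blinfun_compose)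
    ultimately show ?thesis by simp
  qed
  have "theta Q \<xi> \<phi> \<in> SU3" if "\<xi> \<in> U2" "\<phi> \<in> preim_p {\<xi>}" for \<xi> \<phi>
    using theta_SU3[of \<phi>] that by (auto simp: preim_p_def p_G2_def)
  moreover have "fst (psi2 Q \<phi>) = p_G2 \<phi>" for \<phi>
    by (simp add: psi2_def)
  then have "local_trivialization U2 (psi2 Q)"
    unfolding local_trivialization_def diffeomorphism_onto_def
    using bij smooth smooth_inv act by blast
  ultimately show ?thesis by blast
qed

end
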